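(* Let $1\le k\le n$ and $1\le i\le n-k+1$ be integers. The ideal $J_{k,n,i}$ is minimally generated by the monomials $m_\sigma$ with $\sigma\in\mathcal{S}^i_0\cup\mathcal{S}^i_{k}\cup\mathcal{S}^i_{k+1}\cup\cdots$. In other words, the minimal monomial generators of $J_{k,n,i}$ are the monomials $m_\sigma$ for those subsets $\sigma\subseteq\{1,\dots,n-k+1\}$ of cardinality $i$ that have no gaps of sizes $1,2,\ldots,k-1$.
   Context: Let $R=\mathbf{k}[x_1,\dots,x_n]$ be the polynomial ring over a field $\mathbf{k}$. $J_{k,n}\subseteq R$ is the failure ideal of the consecutive $k$-out-of-$n$:F system (the system with $n$ components that fails whenever $k$ consecutive components fail), i.e. $J_{k,n}=\langle m_1,\dots,m_{n-k+1}\rangle$ with $m_t=x_t x_{t+1}\cdots x_{t+k-1}$ for $1\le t\le n-k+1$. For $\sigma\subseteq\{1,\dots,n-k+1\}$ put $m_\sigma=\mathrm{lcm}(\{m_t\}_{t\in\sigma})$. $J_{k,n,i}$ is the $i$-fold lcm-ideal of $J_{k,n}$, i.e. $J_{k,n,i}=\langle m_\sigma:\ \sigma\subseteq\{1,\dots,n-k+1\},\ |\sigma|=i\rangle$. Let $\mathcal{S}$ be the set of (nonempty) subsets of $\{1,\dots,n-k+1\}$. For $\sigma\in\mathcal{S}$, a gap of size $s\ge 1$ of $\sigma$ is a maximal run of $s$ consecutive elements of $\{\min(\sigma),\dots,\max(\sigma)\}$ that are not in $\sigma$. For instance, $\{2,3,6,8\}$ has one gap of size $2$ (namely $4,5$)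 and one gap of size $1$ (namely $7$). For $a\ge 1$, $\mathcal{S}_a$ is the set of those $\sigma\in\mathcal{S}$ whose smallest gap has size $a$; $\mathcal{S}_0$ is the set of those $\sigma\in\mathcal{S}$ having no gaps, i.e. consisting of consecutive integers. $\mathcal{S}^i_a$ is the set of elements of $\mathcal{S}_a$ of cardinality $i$. *)

theory Defs
  imports "HOL-Algebra.Ideal" "HOL-Library.Poly_Mapping"
begin

text \<open>
  An exponent vector \<open>nat \<Rightarrow>\<^sub>0 nat\<close> stands for a monomial in the variables $x_0, x_1, \ldots$;
  polynomials are finitely supported maps from exponent vectors to coefficients, multiplied by
  convolution. The ring in the variables $x_1,\ldots,x_n$ is the subring cut out by its carrier.
\<close>

type_synonym 'a mpoly = "(nat \<Rightarrow>\<^sub>0 nat) \<Rightarrow>\<^sub>0 'a"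

definition poly_ring :: "nat \<Rightarrow> 'a::field mpoly ring" where
  "poly_ring n = \<lparr>carrier = {p. \<forall>e \<in> Poly_Mapping.keys p. Poly_Mapping.keys e \<subseteq> {1..n}},
     mult = (*), one = 1, zero = 0, add = (+)\<rparr>"

lemma cring_poly_ring: "cring (poly_ring n :: 'a::field mpoly ring)"
proof (rule cringI)
  show "abelian_group (poly_ring n :: 'a mpoly ring)"
  proof (rule abelian_groupI)
    fix p q :: "'a mpoly"
    assume "p \<in> carrier (poly_ring n)" "q \<in> carrier (poly_ring n)"
    then show "p \<oplus>\<^bsub>poly_ring n\<^esub> q \<in> carrier (poly_ring n)"
      using Poly_Mapping.keys_add[of p q] unfolding poly_ring_def by auto
  next
    fix p :: "'a mpoly"
    assume "p \<in> carrier (poly_ring n)"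
    then show "\<exists>q\<in>carrier (poly_ring n). q \<oplus>\<^bsub>poly_ring n\<^esub> p = \<zero>\<^bsub>poly_ring n\<^esub>"
      by (intro bexI[of _ "- p"]) (auto simp: poly_ring_def)
  qed (auto simp: poly_ring_def ac_simps)
  show "comm_monoid (poly_ring n :: 'a mpoly ring)"
  proof (rule comm_monoidI)
    fix p q :: "'a mpoly"
    assume "p \<in> carrier (poly_ring n)" "q \<in> carrier (poly_ring n)"
    then have p: "\<And>e. e \<in> Poly_Mapping.keys p \<Longrightarrow> Poly_Mapping.keys e \<subseteq> {1..n}"
      and q: "\<And>e. e \<in> Poly_Mapping.keys q \<Longrightarrow> Poly_Mapping.keys e \<subseteq> {1..n}"
      unfolding poly_ring_def by auto
    have "Poly_Mapping.keys e \<subseteq> {1..n}" if e: "e \<in> Poly_Mapping.keys (p * q)" for e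
    proof -
      obtain a b where "e = a + b" "a \<in> Poly_Mapping.keys p" "b \<in> Poly_Mapping.keys q"
        using Poly_Mapping.keys_mult[of p q] e by blast
      then show ?thesis
        using Poly_Mapping.keys_add[of a b] p[of a] q[of b] by blast
    qed
    then show "p \<otimes>\<^bsub>poly_ring n\<^esub> q \<in> carrier (poly_ring n)"
      by (simp add: poly_ring_def)
  qed (auto simp: poly_ring_def ac_simps)
qed (auto simp: poly_ring_def algebra_simps)

definition monomial :: "(nat \<Rightarrow>\<^sub>0 nat) \<Rightarrow> 'a::field mpoly" where
  "monomial e = Poly_Mapping.single e 1"

definition monomials :: "nat \<Rightarrow> 'a::field mpoly set" where
  "monomials n = monomial ` {e. Poly_Mapping.keys e \<subseteq> {1..n}}"

text \<open>The exponent vector of the lcm of finitely many monomials: the pointwise maximum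
  (the inserted 0 makes the lcm of no monomials equal to 1).\<close>

definition lcm_exp :: "(nat \<Rightarrow>\<^sub>0 nat) set \<Rightarrow> (nat \<Rightarrow>\<^sub>0 nat)" where
  "lcm_exp E = Poly_Mapping.Abs_poly_mapping
     (\<lambda>j. Max (insert 0 ((\<lambda>e. Poly_Mapping.lookup e j) ` E)))"

lemma lookup_lcm_exp:
  assumes "finite E"
  shows "Poly_Mapping.lookup (lcm_exp E) j = Max (insert 0 ((\<lambda>e. Poly_Mapping.lookup e j) ` E))"
proof -
  let ?f = "\<lambda>j. Max (insert 0 ((\<lambda>e. Poly_Mapping.lookup e j) ` E))"
  have "{j. ?f j \<noteq> 0} \<subseteq> (\<Union>e\<in>E. Poly_Mapping.keys e)"
  proof
    fix j assume "j \<in> {j. ?f j \<noteq> 0}"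
    moreover have "?f j \<in> insert 0 ((\<lambda>e. Poly_Mapping.lookup e j) ` E)"
      using assms by (intro Max_in) auto
    ultimately show "j \<in> (\<Union>e\<in>E. Poly_Mapping.keys e)"
      by (auto simp: Poly_Mapping.in_keys_iff)
  qed
  then have "finite {j. ?f j \<noteq> 0}"
    by (rule finite_subset) (use assms in auto)
  then show ?thesis
    unfolding lcm_exp_def by (subst Poly_Mapping.lookup_Abs_poly_mapping) auto
qed

text \<open>$m_t = x_t x_{t+1} \cdots x_{t+k-1}$ (as an exponent vector) and
  $m_\sigma = \mathrm{lcm}(\{m_t\}_{t\in\sigma})$.\<close>

definition path_exp :: "nat \<Rightarrow> nat \<Rightarrow> (nat \<Rightarrow>\<^sub>0 nat)" where
  "path_exp k t = (\<Sum>j\<in>{t..<t+k}. Poly_Mapping.single j 1)"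

definition m_sigma :: "nat \<Rightarrow> nat set \<Rightarrow> 'a::field mpoly" where
  "m_sigma k \<sigma> = monomial (lcm_exp (path_exp k ` \<sigma>))"

definition lcm_ideal :: "nat \<Rightarrow> nat \<Rightarrow> nat \<Rightarrow> 'a::field mpoly set" where
  "lcm_ideal k n i =
     Idl\<^bsub>poly_ring n\<^esub> (m_sigma k ` {\<sigma>. \<sigma> \<subseteq> {1..n-k+1} \<and> card \<sigma> = i})"

definition run_outside :: "nat set \<Rightarrow> nat set \<Rightarrow> bool" where
  "run_outside \<sigma> g \<longleftrightarrow> (\<exists>a b. a \<le> b \<and> g = {a..b}) \<and> g \<subseteq> {Min \<sigma>..Max \<sigma>} - \<sigma>"

definition gaps :: "nat set \<Rightarrow> nat set set" where
  "gaps \<sigma> = {g. run_outside \<sigma> g \<and> (\<forall>h. run_outside \<sigma> h \<and> g \<subseteq> h \<longrightarrow> h = g)}"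

definition gap_sizes :: "nat set \<Rightarrow> nat set" where
  "gap_sizes \<sigma> = card ` gaps \<sigma>"

text \<open>The set $\mathcal{S}^i_a$ of subsets of $\{1,\ldots,N\}$; it is used with $N = n-k+1$.\<close>

definition S_gap :: "nat \<Rightarrow> nat \<Rightarrow> nat \<Rightarrow> nat set set" where
  "S_gap N i a = {\<sigma>. \<sigma> \<noteq> {} \<and> \<sigma> \<subseteq> {1..N} \<and> card \<sigma> = i \<and>
     (if a = 0 then gaps \<sigma> = {}
      else a \<in> gap_sizes \<sigma> \<and> (\<forall>s \<in> gap_sizes \<sigma>. a \<le> s))}"

text \<open>Irredundancy is required of the indexed family, so that two distinct indices
  with the same generator count as redundant.\<close>

definition minimally_generated_by ::
    "('r, 'm) ring_scheme \<Rightarrow> 'r set \<Rightarrow> ('b \<Rightarrow> 'r) \<Rightarrow> 'b set \<Rightarrow> bool" where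
  "minimally_generated_by R I f A \<longleftrightarrow>
     f ` A \<subseteq> carrier R \<and> Idl\<^bsub>R\<^esub> (f ` A) = I \<and> (\<forall>B. B \<subset> A \<longrightarrow> Idl\<^bsub>R\<^esub> (f ` B) \<noteq> I)"

definition minimal_monomial_generators :: "nat \<Rightarrow> 'a::field mpoly set \<Rightarrow> 'a mpoly set \<Rightarrow> bool" where
  "minimal_monomial_generators n I G \<longleftrightarrow>
     G \<subseteq> monomials n \<and> minimally_generated_by (poly_ring n) I (\<lambda>g. g) G"

end

theory Submission
  imports Defs
begin

text \<open>
  The monomial of \<open>\<sigma>\<close> is the squarefree monomial of the set \<open>cover k \<sigma>\<close> of all indices lying in some
  \<open>{t..<t+k}\<close> with \<open>t \<in> \<sigma>\<close>, and divisibility of these monomials is inclusion of covers. A set has no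
  gaps of sizes \<open>1, \<dots>, k-1\<close> exactly when it is saturated, i.e.\ contains every \<open>t\<close> whose window
  \<open>{t..<t+k}\<close> it covers; hence among saturated sets inclusion of covers is inclusion of sets, and
  saturated sets of equal cardinality give an antichain. Conversely the saturation of an \<open>i\<close>-set has
  the same cover, and deleting maximal elements keeps it saturated, so every generator is divisible by
  the monomial of a saturated \<open>i\<close>-set. An antichain of monomials generating a monomial ideal is
  its unique minimal set of monomial generators.
\<close>

subsection \<open>Monomial ideals\<close>

text \<open>Divisibility of monomials, read off their exponent vectors.\<close>

definition exp_le :: "('x \<Rightarrow>\<^sub>0 nat) \<Rightarrow> ('x \<Rightarrow>\<^sub>0 nat) \<Rightarrow> bool" where
  "exp_le a e \<longleftrightarrow> (\<forall>j. Poly_Mapping.lookup a j \<le> Poly_Mapping.lookup e j)"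

lemma exp_le_refl [simp]: "exp_le e e"
  by (simp add: exp_le_def)

lemma exp_le_trans: "exp_le a b \<Longrightarrow> exp_le b c \<Longrightarrow> exp_le a c"
  unfolding exp_le_def by (meson order_trans)

lemma exp_le_antisym: "exp_le a b \<Longrightarrow> exp_le b a \<Longrightarrow> a = b"
  unfolding exp_le_def by (intro poly_mapping_eqI) (simp add: order_antisym)

lemma exp_le_add: "exp_le a e \<Longrightarrow> exp_le a (e + c)"
  unfolding exp_le_def by (simp add: lookup_add trans_le_add1)

lemma keys_monomial [simp]: "Poly_Mapping.keys (monomial e :: 'a::field mpoly) = {e}"
  by (simp add: monomial_def)

lemma inj_monomial: "inj (monomial :: _ \<Rightarrow> 'a::field mpoly)"
  by (rule injI) (metis keys_monomial singleton_inject)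

lemma monomial_mult: "monomial a * monomial b = (monomial (a + b) :: 'a::field mpoly)"
  by (simp add: monomial_def mult_single)

lemma ring_poly_ring: "ring (poly_ring n :: 'a::field mpoly ring)"
  using cring_poly_ring by (rule cring.axioms)

lemma monomial_in_carrier:
  "monomial e \<in> carrier (poly_ring n :: 'a::field mpoly ring) \<longleftrightarrow> Poly_Mapping.keys e \<subseteq> {1..n}"
  by (simp add: poly_ring_def)

lemma a_inv_poly_ring:
  assumes "p \<in> carrier (poly_ring n :: 'a::field mpoly ring)"
  shows "\<ominus>\<^bsub>poly_ring n\<^esub> p = - p"
proof -
  interpret R: ring "poly_ring n :: 'a mpoly ring" by (rule ring_poly_ring)
  show ?thesis
    by (rule R.minus_equality) (use assms in \<open>auto simp: poly_ring_def\<close>)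
qed

text \<open>Multiplying only raises exponents, so divisibility of every term by some monomial of
  \<open>E\<close> survives products as well as sums. This gives an upper bound for a generated
  ideal without writing its elements as combinations of generators.\<close>

lemma ideal_exponent_upset:
  "ideal {p \<in> carrier (poly_ring n :: 'a::field mpoly ring).
      \<forall>e \<in> Poly_Mapping.keys p. \<exists>a\<in>E. exp_le a e} (poly_ring n)" (is "ideal ?I _")
proof (rule idealI)
  interpret R: ring "poly_ring n :: 'a mpoly ring" by (rule ring_poly_ring)
  show "ring (poly_ring n :: 'a mpoly ring)" by (rule ring_poly_ring)
  show "subgroup ?I (add_monoid (poly_ring n))"
  proof (rule R.add.subgroupI)
    have "0 \<in> ?I" by (simp add: poly_ring_def)
    then show "?I \<noteq> {}" by blast
    fix p assume p: "p \<in> ?I"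
    show "\<ominus>\<^bsub>poly_ring n\<^esub> p \<in> ?I"
      using p R.a_inv_closed[of p] by (auto simp: a_inv_poly_ring)
    fix q assume q: "q \<in> ?I"
    have "p + q \<in> carrier (poly_ring n)"
      using p q R.a_closed[of p q] by (simp add: poly_ring_def)
    then show "p \<oplus>\<^bsub>poly_ring n\<^esub> q \<in> ?I"
      using p q Poly_Mapping.keys_add[of p q] by (auto simp: poly_ring_def)
  qed auto
  fix p q :: "'a mpoly"
  assume p: "p \<in> ?I" and q: "q \<in> carrier (poly_ring n)"
  have *: "q \<otimes>\<^bsub>poly_ring n\<^esub> p = p * q" "p \<otimes>\<^bsub>poly_ring n\<^esub> q = p * q"
    by (simp_all add: poly_ring_def mult.commute)
  have "p * q \<in> carrier (poly_ring n)"
    using p q R.m_closed[of p q] by (simp add: poly_ring_def)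
  moreover have "\<exists>a\<in>E. exp_le a e" if e: "e \<in> Poly_Mapping.keys (p * q)" for e
  proof -
    obtain b c where "e = b + c" "b \<in> Poly_Mapping.keys p"
      using Poly_Mapping.keys_mult[of p q] e by blast
    then show ?thesis using p exp_le_add by blast
  qed
  ultimately have "p * q \<in> ?I" by blast
  then show "q \<otimes>\<^bsub>poly_ring n\<^esub> p \<in> ?I" "p \<otimes>\<^bsub>poly_ring n\<^esub> q \<in> ?I"
    by (simp_all only: *)
qed

text \<open>One direction compares the generated ideal with the ideal of
  \<open>ideal_exponent_upset\<close>; the other multiplies a generator by the quotient
  monomial.\<close>

lemma monomial_in_genideal_iff:
  assumes E: "\<And>a. a \<in> E \<Longrightarrow> Poly_Mapping.keys a \<subseteq> {1..n}"
  shows "(monomial e :: 'a::field mpoly) \<in> Idl\<^bsub>poly_ring n\<^esub> (monomial ` E) \<longleftrightarrow>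
    Poly_Mapping.keys e \<subseteq> {1..n} \<and> (\<exists>a\<in>E. exp_le a e)"
proof -
  interpret R: ring "poly_ring n :: 'a mpoly ring" by (rule ring_poly_ring)
  have sub: "monomial ` E \<subseteq> carrier (poly_ring n :: 'a mpoly ring)"
    using E by (auto simp: monomial_in_carrier)
  show ?thesis
  proof
    assume "(monomial e :: 'a mpoly) \<in> Idl\<^bsub>poly_ring n\<^esub> (monomial ` E)"
    moreover have "Idl\<^bsub>poly_ring n\<^esub> (monomial ` E) \<subseteq> {p \<in> carrier (poly_ring n :: 'a mpoly ring).
      \<forall>e \<in> Poly_Mapping.keys p. \<exists>a\<in>E. exp_le a e}"
      by (rule R.genideal_minimal[OF ideal_exponent_upset])
        (use sub in \<open>auto intro: exp_le_refl\<close>)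
    ultimately show "Poly_Mapping.keys e \<subseteq> {1..n} \<and> (\<exists>a\<in>E. exp_le a e)"
      using monomial_in_carrier[of e n, where 'a = 'a] by auto
  next
    assume e: "Poly_Mapping.keys e \<subseteq> {1..n} \<and> (\<exists>a\<in>E. exp_le a e)"
    then obtain a where a: "a \<in> E" "exp_le a e" by blast
    \<comment> \<open>Subtraction of exponent vectors is truncated; \<open>exp_le a e\<close> makes
      it exact.\<close>
    have eq: "e = (e - a) + a"
      using a(2) by (intro poly_mapping_eqI) (simp add: lookup_add lookup_minus exp_le_def)
    have "Poly_Mapping.keys (e - a) \<subseteq> Poly_Mapping.keys e"
      by (auto simp: in_keys_iff lookup_minus)
    then have c: "(monomial (e - a) :: 'a mpoly) \<in> carrier (poly_ring n)"
      using e by (auto simp: monomial_in_carrier)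
    have "(monomial a :: 'a mpoly) \<in> Idl\<^bsub>poly_ring n\<^esub> (monomial ` E)"
      using R.genideal_self[OF sub] a(1) by blast
    from ideal.I_l_closed[OF R.genideal_ideal[OF sub] this c]
    have "(monomial (e - a) * monomial a :: 'a mpoly) \<in> Idl\<^bsub>poly_ring n\<^esub> (monomial ` E)"
      by (simp add: poly_ring_def)
    then show "(monomial e :: 'a mpoly) \<in> Idl\<^bsub>poly_ring n\<^esub> (monomial ` E)"
      using eq monomial_mult by metis
  qed
qed

text \<open>Inclusion of ideals is decided on the generators of the smaller one, where membership is
  divisibility. All later comparisons of ideals go through this criterion.\<close>

lemma genideal_monomial_subset_iff:
  assumes E: "\<And>a. a \<in> E \<Longrightarrow> Poly_Mapping.keys a \<subseteq> {1..n}"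
    and F: "\<And>a. a \<in> F \<Longrightarrow> Poly_Mapping.keys a \<subseteq> {1..n}"
  shows "Idl\<^bsub>poly_ring n\<^esub> (monomial ` F :: 'a::field mpoly set) \<subseteq> Idl\<^bsub>poly_ring n\<^esub> (monomial ` E)
    \<longleftrightarrow> (\<forall>e\<in>F. \<exists>a\<in>E. exp_le a e)"
proof -
  interpret R: ring "poly_ring n :: 'a mpoly ring" by (rule ring_poly_ring)
  have sub: "monomial ` E \<subseteq> carrier (poly_ring n :: 'a mpoly ring)"
    "monomial ` F \<subseteq> carrier (poly_ring n :: 'a mpoly ring)"
    using E F by (auto simp: monomial_in_carrier)
  have "Idl\<^bsub>poly_ring n\<^esub> (monomial ` F :: 'a mpoly set) \<subseteq> Idl\<^bsub>poly_ring n\<^esub> (monomial ` E)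
    \<longleftrightarrow> monomial ` F \<subseteq> Idl\<^bsub>poly_ring n\<^esub> (monomial ` E :: 'a mpoly set)"
    using R.genideal_minimal[OF R.genideal_ideal[OF sub(1)]] R.genideal_self[OF sub(2)] by blast
  also have "\<dots> \<longleftrightarrow> (\<forall>e\<in>F. \<exists>a\<in>E. exp_le a e)"
    using F by (auto simp: monomial_in_genideal_iff[OF E])
  finally show ?thesis .
qed

section \<open>Minimal generation and uniqueness of minimal monomial generators\<close>

lemma minimally_generated_by_monomialI:
  fixes f :: "'b \<Rightarrow> nat \<Rightarrow>\<^sub>0 nat"
  assumes keys: "\<And>a. a \<in> A \<Longrightarrow> Poly_Mapping.keys (f a) \<subseteq> {1..n}"
    and anti: "\<And>a b. a \<in> A \<Longrightarrow> b \<in> A \<Longrightarrow> exp_le (f a) (f b) \<Longrightarrow> a = b"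
    and gen: "Idl\<^bsub>poly_ring n\<^esub> ((\<lambda>a. monomial (f a)) ` A) = (I :: 'a::field mpoly set)"
  shows "minimally_generated_by (poly_ring n) I (\<lambda>a. monomial (f a)) A"
  unfolding minimally_generated_by_def
proof (intro conjI allI impI gen)
  show "(\<lambda>a. monomial (f a)) ` A \<subseteq> carrier (poly_ring n :: 'a mpoly ring)"
    using keys by (auto simp: monomial_in_carrier)
  fix B assume B: "B \<subset> A"
  then obtain a where a: "a \<in> A" "a \<notin> B" by blast
  show "Idl\<^bsub>poly_ring n\<^esub> ((\<lambda>a. monomial (f a)) ` B) \<noteq> I"
  proof
    assume "Idl\<^bsub>poly_ring n\<^esub> ((\<lambda>a. monomial (f a)) ` B) = I"
    then have "Idl\<^bsub>poly_ring n\<^esub> (monomial ` f ` A :: 'a mpoly set) \<subseteq> Idl\<^bsub>poly_ring n\<^esub> (monomial ` f ` B)"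
      using gen by (simp add: image_image)
    then have "\<forall>e\<in>f ` A. \<exists>b\<in>f ` B. exp_le b e"
      by (subst (asm) genideal_monomial_subset_iff) (use keys B in auto)
    \<comment> \<open>A monomial indexed by \<open>B\<close> divides the one at the dropped index
      \<open>a\<close>. Since \<open>anti\<close> identifies the indices and not just the monomials,
      repeated generators are excluded too.\<close>
    then obtain b where "b \<in> B" "exp_le (f b) (f a)" using a by blast
    then show False using anti[of b a] a B by blast
  qed
qed

text \<open>A proper subset of the image pulls back to a proper subset of the index set with that
  same image. The converse can fail when \<open>f\<close> is not injective.\<close>

lemma minimally_generated_by_image:
  assumes "minimally_generated_by R I f A"
  shows "minimally_generated_by R I (\<lambda>g. g) (f ` A)"
  unfolding minimally_generated_by_def
proof (intro conjI allI impI)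
  show "(\<lambda>g. g) ` f ` A \<subseteq> carrier R" "Idl\<^bsub>R\<^esub> ((\<lambda>g. g) ` f ` A) = I"
    using assms by (auto simp: minimally_generated_by_def)
  fix B assume B: "B \<subset> f ` A"
  then have "B = f ` {a \<in> A. f a \<in> B}" "{a \<in> A. f a \<in> B} \<subset> A" by blast+
  then show "Idl\<^bsub>R\<^esub> ((\<lambda>g. g) ` B) \<noteq> I"
    using assms unfolding minimally_generated_by_def by (metis image_ident)
qed

text \<open>If \<open>a\<close> properly divided \<open>b\<close>, then \<open>b\<close> could be
  dropped without changing the ideal.\<close>

lemma minimal_monomial_generators_antichain:
  assumes G: "minimal_monomial_generators n (I :: 'a::field mpoly set) (monomial ` E)"
    and a: "a \<in> E" and b: "b \<in> E" and le: "exp_le a b"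
  shows "a = b"
proof (rule ccontr)
  assume ne: "a \<noteq> b"
  have keys: "Poly_Mapping.keys e \<subseteq> {1..n}" if "e \<in> E" for e
    using G that inj_monomial[where 'a = 'a]
    unfolding minimal_monomial_generators_def monomials_def by (auto dest: injD)
  have "\<forall>e\<in>E. \<exists>c\<in>E - {b}. exp_le c e"
  proof
    fix e assume "e \<in> E"
    then show "\<exists>c\<in>E - {b}. exp_le c e"
      using a le ne exp_le_refl by (cases "e = b") blast+
  qed
  then have "Idl\<^bsub>poly_ring n\<^esub> (monomial ` E :: 'a mpoly set) \<subseteq> Idl\<^bsub>poly_ring n\<^esub> (monomial ` (E - {b}))"
    by (subst genideal_monomial_subset_iff) (use keys in auto)
  moreover have "Idl\<^bsub>poly_ring n\<^esub> (monomial ` (E - {b}) :: 'a mpoly set) \<subseteq> Idl\<^bsub>poly_ring n\<^esub> (monomial ` E)"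
    by (subst genideal_monomial_subset_iff) (use keys in \<open>auto intro: exp_le_refl\<close>)
  ultimately have "Idl\<^bsub>poly_ring n\<^esub> (monomial ` (E - {b}) :: 'a mpoly set) = I"
    using G by (auto simp: minimal_monomial_generators_def minimally_generated_by_def)
  moreover have "(monomial ` (E - {b}) :: 'a mpoly set) \<subset> monomial ` E"
    using b inj_monomial[where 'a = 'a] by (auto dest: injD)
  ultimately show False
    using G by (auto simp: minimal_monomial_generators_def minimally_generated_by_def)
qed

text \<open>Divisibility goes back and forth: a generator \<open>e\<close> of one set has a divisor
  \<open>a\<close> in the other, which has a divisor \<open>c\<close> in the first. The antichain
  property gives \<open>c = e\<close>, which squeezes \<open>a\<close> to \<open>e\<close>.\<close>

lemma minimal_monomial_generators_unique:
  assumes G: "minimal_monomial_generators n (I :: 'a::field mpoly set) G"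
    and H: "minimal_monomial_generators n I H"
  shows "G = H"
proof -
  have *: "G \<subseteq> H" if "minimal_monomial_generators n I G" "minimal_monomial_generators n I H"
    for G H :: "'a mpoly set"
  proof -
    have "G \<subseteq> monomial ` {e. Poly_Mapping.keys e \<subseteq> {1..n}}"
      using that(1) by (simp add: minimal_monomial_generators_def monomials_def)
    then obtain E where E: "G = monomial ` E"
      "\<And>e. e \<in> E \<Longrightarrow> Poly_Mapping.keys e \<subseteq> {1..n}"
      by (auto elim!: subset_imageE)
    have "H \<subseteq> monomial ` {e. Poly_Mapping.keys e \<subseteq> {1..n}}"
      using that(2) by (simp add: minimal_monomial_generators_def monomials_def)
    then obtain F where F: "H = monomial ` F"
      "\<And>e. e \<in> F \<Longrightarrow> Poly_Mapping.keys e \<subseteq> {1..n}"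
      by (auto elim!: subset_imageE)
    have "Idl\<^bsub>poly_ring n\<^esub> G = I" "Idl\<^bsub>poly_ring n\<^esub> H = I"
      using that by (auto simp: minimal_monomial_generators_def minimally_generated_by_def)
    then have EF: "\<forall>e\<in>E. \<exists>a\<in>F. exp_le a e" and FE: "\<forall>e\<in>F. \<exists>a\<in>E. exp_le a e"
      using genideal_monomial_subset_iff[of E n F, where 'a = 'a]
        genideal_monomial_subset_iff[of F n E, where 'a = 'a] E F by auto
    have "e \<in> F" if e: "e \<in> E" for e
    proof -
      obtain a where a: "a \<in> F" "exp_le a e" using EF e by blast
      obtain c where c: "c \<in> E" "exp_le c a" using FE a by blast
      have "c = e"
        using minimal_monomial_generators_antichain[of n I E c e] c e a E(1)
          \<open>minimal_monomial_generators n I G\<close> exp_le_trans by blast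
      then show ?thesis using a c exp_le_antisym by blast
    qed
    then show ?thesis using E(1) F(1) by blast
  qed
  show ?thesis using *[OF G H] *[OF H G] by blast
qed

subsection \<open>Covers and saturated sets\<close>

definition cover :: "nat \<Rightarrow> nat set \<Rightarrow> nat set" where
  "cover k \<sigma> = (\<Union>t\<in>\<sigma>. {t..<t + k})"

text \<open>The closed sets of the closure operator that adds every window start already covered.
  Here \<open>t\<close> ranges over all naturals; \<open>cover_subset_iff\<close> later confines the
  closure to \<open>{1..n - k + 1}\<close>.\<close>

definition saturated :: "nat \<Rightarrow> nat set \<Rightarrow> bool" where
  "saturated k \<sigma> \<longleftrightarrow> (\<forall>t. {t..<t + k} \<subseteq> cover k \<sigma> \<longrightarrow> t \<in> \<sigma>)"

lemma cover_mono: "\<sigma> \<subseteq> \<tau> \<Longrightarrow> cover k \<sigma> \<subseteq> cover k \<tau>"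
  by (auto simp: cover_def)

text \<open>The window of each element of \<open>\<tau>\<close> lies in the cover of
  \<open>\<sigma>\<close>, so saturation applies to it. Thus on saturated sets the order of covers
  reflects the order of sets.\<close>

lemma saturated_cover_subset: "saturated k \<sigma> \<Longrightarrow> cover k \<tau> \<subseteq> cover k \<sigma> \<Longrightarrow> \<tau> \<subseteq> \<sigma>"
  unfolding saturated_def cover_def by blast

lemma lookup_path_exp:
  "Poly_Mapping.lookup (path_exp k t) j = (if j \<in> {t..<t + k} then 1 else 0)"
  by (simp add: path_exp_def lookup_sum lookup_single when_def)

lemma lookup_m_sigma_exp:
  assumes "finite \<sigma>"
  shows "Poly_Mapping.lookup (lcm_exp (path_exp k ` \<sigma>)) j = (if j \<in> cover k \<sigma> then 1 else 0)"
proof -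
  have "Poly_Mapping.lookup (lcm_exp (path_exp k ` \<sigma>)) j
    = Max (insert 0 ((\<lambda>t. if j \<in> {t..<t + k} then 1 else 0) ` \<sigma>))"
    using assms by (simp add: lookup_lcm_exp image_image lookup_path_exp)
  also have "\<dots> = (if j \<in> cover k \<sigma> then 1 else 0)"
    by (rule Max_eqI) (use assms in \<open>auto simp: cover_def\<close>)
  finally show ?thesis .
qed

lemma exp_le_m_sigma_iff:
  assumes "finite \<sigma>" "finite \<tau>"
  shows "exp_le (lcm_exp (path_exp k ` \<sigma>)) (lcm_exp (path_exp k ` \<tau>)) \<longleftrightarrow>
    cover k \<sigma> \<subseteq> cover k \<tau>"
  using assms by (auto simp: exp_le_def lookup_m_sigma_exp)

lemma keys_m_sigma_exp:
  "finite \<sigma> \<Longrightarrow> Poly_Mapping.keys (lcm_exp (path_exp k ` \<sigma>)) = cover k \<sigma>"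
  by (auto simp: in_keys_iff lookup_m_sigma_exp split: if_splits)

text \<open>Only the two ends \<open>t\<close> and \<open>t + k - 1\<close> of a window matter.
  Besides bounding the variables of the monomials, this shows that sets with equal covers obey the
  same range restriction.\<close>

lemma cover_subset_iff:
  assumes "1 \<le> k" "k \<le> n"
  shows "cover k \<sigma> \<subseteq> {1..n} \<longleftrightarrow> \<sigma> \<subseteq> {1..n - k + 1}"
proof
  assume L: "cover k \<sigma> \<subseteq> {1..n}"
  show "\<sigma> \<subseteq> {1..n - k + 1}"
  proof
    fix t assume "t \<in> \<sigma>"
    then have "t \<in> cover k \<sigma>" "t + k - 1 \<in> cover k \<sigma>"
      using assms by (auto simp: cover_def intro!: bexI[of _ t])
    then show "t \<in> {1..n - k + 1}" using L assms by fastforce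
  qed
next
  assume R: "\<sigma> \<subseteq> {1..n - k + 1}"
  show "cover k \<sigma> \<subseteq> {1..n}"
  proof
    fix j assume "j \<in> cover k \<sigma>"
    then obtain t where "t \<in> \<sigma>" "t \<le> j" "j < t + k" by (auto simp: cover_def)
    then show "j \<in> {1..n}" using R assms by fastforce
  qed
qed

lemma saturated_remove_Max:
  assumes "finite \<sigma>" "\<sigma> \<noteq> {}" "1 \<le> k" "saturated k \<sigma>"
  shows "saturated k (\<sigma> - {Max \<sigma>})"
  unfolding saturated_def
proof (intro allI impI)
  fix t assume t: "{t..<t + k} \<subseteq> cover k (\<sigma> - {Max \<sigma>})"
  then have "t \<in> \<sigma>"
    using assms(4) cover_mono[of "\<sigma> - {Max \<sigma>}" \<sigma> k] unfolding saturated_def by blast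
  moreover have "t \<noteq> Max \<sigma>"
  proof
    assume "t = Max \<sigma>"
    \<comment> \<open>The last index of the window at \<open>Max \<sigma>\<close> lies beyond every
      window that starts earlier.\<close>
    moreover have "t + k - 1 \<in> cover k (\<sigma> - {Max \<sigma>})" using t assms(3) by auto
    then obtain u where u: "u \<in> \<sigma>" "u \<noteq> Max \<sigma>" "t + k - 1 < u + k"
      by (auto simp: cover_def)
    moreover have "u \<le> Max \<sigma>" using u assms(1) by simp
    ultimately show False by linarith
  qed
  ultimately show "t \<in> \<sigma> - {Max \<sigma>}" by blast
qed

text \<open>Maxima are removed one at a time until \<open>i\<close> elements remain.\<close>

lemma saturated_subset_card:
  assumes "finite C" "1 \<le> k" "saturated k C" "i \<le> card C"
  shows "\<exists>\<sigma>\<subseteq>C. saturated k \<sigma> \<and> card \<sigma> = i"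
  using assms(1,3,4)
proof (induction "card C" arbitrary: C)
  case 0
  then show ?case by auto
next
  case (Suc m)
  show ?case
  proof (cases "i = card C")
    case True
    then show ?thesis using Suc by blast
  next
    case False
    have ne: "C \<noteq> {}" using Suc by auto
    have c: "card (C - {Max C}) = m" using Suc ne by (simp add: card_Diff_singleton)
    then have "\<exists>\<sigma>\<subseteq>C - {Max C}. saturated k \<sigma> \<and> card \<sigma> = i"
      using Suc False ne saturated_remove_Max[OF _ ne assms(2)] by (intro Suc(1)) auto
    then show ?thesis by blast
  qed
qed

lemma ex_saturated_below:
  assumes "1 \<le> k" "k \<le> n" "\<tau> \<subseteq> {1..n - k + 1}"
  shows "\<exists>\<sigma>\<subseteq>{1..n - k + 1}. card \<sigma> = card \<tau> \<and> saturated k \<sigma> \<and> cover k \<sigma> \<subseteq> cover k \<tau>"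
proof -
  \<comment> \<open>The saturation of \<open>\<tau>\<close>, the largest set with the same cover. It
    has at least \<open>card \<tau>\<close> elements, and trimming it can only shrink the
    cover.\<close>
  define C where "C = {t. {t..<t + k} \<subseteq> cover k \<tau>}"
  have cov: "cover k C = cover k \<tau>" unfolding C_def by (auto simp: cover_def)
  have tC: "\<tau> \<subseteq> C" unfolding C_def by (auto simp: cover_def)
  have sat: "saturated k C" unfolding saturated_def cov by (simp add: C_def)
  have CN: "C \<subseteq> {1..n - k + 1}"
    using cover_subset_iff[OF assms(1,2)] assms(3) cov by metis
  then have fin: "finite C" by (rule finite_subset) simp
  then obtain \<sigma> where \<sigma>: "\<sigma> \<subseteq> C" "saturated k \<sigma>" "card \<sigma> = card \<tau>"
    using saturated_subset_card[OF fin assms(1) sat] card_mono[OF fin tC] by blast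
  have "cover k \<sigma> \<subseteq> cover k \<tau>" using cover_mono[OF \<sigma>(1), of k] cov by simp
  then show ?thesis using \<sigma> CN by (intro exI[of _ \<sigma>]) auto
qed

subsection \<open>Gaps\<close>

text \<open>If a neighbour of the run were missing from \<open>\<sigma>\<close>, the run could be
  extended, against maximality. The extension stays inside
  \<open>{Min \<sigma>..Max \<sigma>}\<close> because both extremes belong to
  \<open>\<sigma>\<close>.\<close>

lemma gaps_neighbours:
  assumes fin: "finite \<sigma>" "\<sigma> \<noteq> {}" and g: "{a..b} \<in> gaps \<sigma>" and ab: "a \<le> b"
  shows "0 < a" "a - 1 \<in> \<sigma>" "Suc b \<in> \<sigma>" "{a..b} \<inter> \<sigma> = {}"
proof -
  have sub: "{a..b} \<subseteq> {Min \<sigma>..Max \<sigma>} - \<sigma>"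
    and maxi: "\<And>h. run_outside \<sigma> h \<Longrightarrow> {a..b} \<subseteq> h \<Longrightarrow> h = {a..b}"
    using g by (auto simp: gaps_def run_outside_def)
  show "{a..b} \<inter> \<sigma> = {}" using sub by blast
  have "a \<in> {Min \<sigma>..Max \<sigma>} - \<sigma>" "b \<in> {Min \<sigma>..Max \<sigma>} - \<sigma>" using sub ab by auto
  then have a: "Min \<sigma> < a" and b: "b < Max \<sigma>"
    using Min_in[OF fin] Max_in[OF fin] by (auto simp: less_le)
  then show a0: "0 < a" by simp
  show "a - 1 \<in> \<sigma>"
  proof (rule ccontr)
    assume "a - 1 \<notin> \<sigma>"
    moreover have "{a - 1..b} = insert (a - 1) {a..b}" using ab a0 by auto
    ultimately have "run_outside \<sigma> {a - 1..b}"
      unfolding run_outside_def using sub a b ab by (intro conjI exI[of _ "a - 1"] exI[of _ b]) auto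
    then have "{a - 1..b} = {a..b}" by (rule maxi) auto
    then have "a - 1 = a" using ab by (simp add: Icc_eq_Icc)
    then show False using a0 by simp
  qed
  show "Suc b \<in> \<sigma>"
  proof (rule ccontr)
    assume "Suc b \<notin> \<sigma>"
    moreover have "{a..Suc b} = insert (Suc b) {a..b}" using ab by auto
    ultimately have "run_outside \<sigma> {a..Suc b}"
      unfolding run_outside_def using sub a b ab by (intro conjI exI[of _ a] exI[of _ "Suc b"]) auto
    then have "{a..Suc b} = {a..b}" by (rule maxi) auto
    then show False using ab by (simp add: Icc_eq_Icc)
  qed
qed

text \<open>A longer interval would have to contain \<open>u\<close> or \<open>v\<close>, both of
  which lie in \<open>\<sigma>\<close>.\<close>

lemma gaps_between:
  assumes fin: "finite \<sigma>" and "u \<in> \<sigma>" "v \<in> \<sigma>" "Suc u < v" and empty: "{Suc u..v - 1} \<inter> \<sigma> = {}"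
  shows "{Suc u..v - 1} \<in> gaps \<sigma>"
proof -
  have "Min \<sigma> \<le> u" "v \<le> Max \<sigma>" using assms by auto
  then have "{Suc u..v - 1} \<subseteq> {Min \<sigma>..Max \<sigma>} - \<sigma>" using empty by auto
  moreover have "Suc u \<le> v - 1" using assms(4) by simp
  ultimately have run: "run_outside \<sigma> {Suc u..v - 1}"
    unfolding run_outside_def by blast
  have "h = {Suc u..v - 1}" if h: "run_outside \<sigma> h" "{Suc u..v - 1} \<subseteq> h" for h
  proof -
    obtain a b where ab: "a \<le> b" "h = {a..b}" using h(1) by (auto simp: run_outside_def)
    have "u \<notin> h" "v \<notin> h" using h(1) assms(2,3) by (auto simp: run_outside_def)
    moreover have "a \<le> Suc u" "v - 1 \<le> b" using h(2) ab assms(4) by auto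
    ultimately show ?thesis using ab assms(4) by auto
  qed
  then show ?thesis using run by (auto simp: gaps_def)
qed

text \<open>A gap shorter than \<open>k\<close> is bridged by the windows of its two neighbours, so
  its first element violates saturation. Conversely, a missing \<open>t\<close> with covered window
  sits in a gap; if that gap had size at least \<open>k\<close>, some index of the window would be
  uncovered.\<close>

lemma saturated_iff_no_small_gaps:
  assumes k: "1 \<le> k" and fin: "finite \<sigma>" "\<sigma> \<noteq> {}"
  shows "saturated k \<sigma> \<longleftrightarrow> (\<forall>s\<in>{1..k - 1}. s \<notin> gap_sizes \<sigma>)"
proof
  assume sat: "saturated k \<sigma>"
  show "\<forall>s\<in>{1..k - 1}. s \<notin> gap_sizes \<sigma>"
  proof (intro ballI notI)
    fix s assume s: "s \<in> {1..k - 1}" "s \<in> gap_sizes \<sigma>"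
    then obtain g where g: "g \<in> gaps \<sigma>" "card g = s" by (auto simp: gap_sizes_def)
    then obtain a b where ab: "a \<le> b" "g = {a..b}" by (auto simp: gaps_def run_outside_def)
    note nb = gaps_neighbours[OF fin g(1)[unfolded ab(2)] ab(1)]
    \<comment> \<open>The bound on the gap size says that the window at \<open>Suc b\<close> starts
      early enough to reach \<open>a + k - 1\<close>, the one index of the window at
      \<open>a\<close> that the window at \<open>a - 1\<close> misses.\<close>
    have len: "Suc b \<le> a + k - 1" using s g ab by auto
    have "{a..<a + k} \<subseteq> cover k \<sigma>"
    proof
      fix j assume j: "j \<in> {a..<a + k}"
      show "j \<in> cover k \<sigma>"
      proof (cases "j = a + k - 1")
        case True
        then have "j \<in> {Suc b..<Suc b + k}" using len ab(1) by auto
        then show ?thesis using nb(3) unfolding cover_def by blast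
      next
        case False
        then have "j \<in> {a - 1..<a - 1 + k}" using j nb(1) by auto
        then show ?thesis using nb(2) unfolding cover_def by blast
      qed
    qed
    then have "a \<in> \<sigma>" using sat by (auto simp: saturated_def)
    then show False using nb(4) ab(1) by auto
  qed
next
  assume ns: "\<forall>s\<in>{1..k - 1}. s \<notin> gap_sizes \<sigma>"
  show "saturated k \<sigma>"
    unfolding saturated_def
  proof (intro allI impI, rule ccontr)
    fix t assume t: "{t..<t + k} \<subseteq> cover k \<sigma>" and nt: "t \<notin> \<sigma>"
    \<comment> \<open>The first index of the window forces an element of \<open>\<sigma>\<close>
      below \<open>t\<close>, the last index one above it.\<close>
    have "t \<in> cover k \<sigma>" "t + k - 1 \<in> cover k \<sigma>" using t k by auto
    then obtain u0 v0 where u0: "u0 \<in> \<sigma>" "u0 \<le> t" "t < u0 + k"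
      and v0: "v0 \<in> \<sigma>" "v0 \<le> t + k - 1" "t + k - 1 < v0 + k"
      by (auto simp: cover_def)
    have u0t: "u0 < t" using u0 nt by (metis le_neq_implies_less)
    have "t \<le> v0" using v0(3) k by arith
    then have v0t: "t < v0" using v0(1) nt by (metis le_neq_implies_less)
    define u where "u = Max {x\<in>\<sigma>. x < t}"
    define v where "v = Min {x\<in>\<sigma>. t < x}"
    have "u \<in> {x\<in>\<sigma>. x < t}" unfolding u_def by (rule Max_in) (use fin u0 u0t in auto)
    moreover have "v \<in> {x\<in>\<sigma>. t < x}" unfolding v_def by (rule Min_in) (use fin v0 v0t in auto)
    ultimately have uv: "u \<in> \<sigma>" "u < t" "v \<in> \<sigma>" "t < v" by auto
    have umax: "x \<le> u" if "x \<in> \<sigma>" "x < t" for x unfolding u_def using that fin by auto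
    have vmin: "v \<le> x" if "x \<in> \<sigma>" "t < x" for x unfolding v_def using that fin by auto
    have between: "x \<le> u \<or> v \<le> x" if "x \<in> \<sigma>" for x
      using umax[OF that] vmin[OF that] nt that by (metis linorder_neqE_nat)
    have "{Suc u..v - 1} \<in> gaps \<sigma>"
      by (rule gaps_between) (use fin uv between in fastforce)+
    then have "card {Suc u..v - 1} \<in> gap_sizes \<sigma>" unfolding gap_sizes_def by (rule imageI)
    then have "v - 1 - u \<notin> {1..k - 1}" using ns by auto
    then have size: "u + k < v" using uv by auto
    \<comment> \<open>The index \<open>u + k\<close> is the uncovered one: a window containing it
      starts in \<open>{u + 1..u + k}\<close>, which lies inside the gap between \<open>u\<close>
      and \<open>v\<close>.\<close>
    have "u + k \<in> {t..<t + k}" using umax[OF u0(1) u0t] u0 uv by auto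
    then have "u + k \<in> cover k \<sigma>" using t by blast
    then obtain w where w: "w \<in> \<sigma>" "w \<le> u + k" "u + k < w + k" by (auto simp: cover_def)
    then show False using between[OF w(1)] size by linarith
  qed
qed

section \<open>The index set of the theorem, sorted by least gap size\<close>

lemma S_gap_Un_eq:
  assumes "1 \<le> k" "1 \<le> i"
  shows "S_gap N i 0 \<union> (\<Union>a\<in>{k..}. S_gap N i a) =
    {\<sigma>. \<sigma> \<subseteq> {1..N} \<and> card \<sigma> = i \<and> (\<forall>s\<in>{1..k - 1}. s \<notin> gap_sizes \<sigma>)}" (is "?L = ?R")
proof (intro equalityI subsetI)
  fix \<sigma> assume "\<sigma> \<in> ?L"
  then consider "\<sigma> \<in> S_gap N i 0" | a where "k \<le> a" "\<sigma> \<in> S_gap N i a" by blast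
  then show "\<sigma> \<in> ?R"
  proof cases
    case 1
    then show ?thesis by (simp add: S_gap_def gap_sizes_def)
  next
    case 2
    then have "a \<noteq> 0" using assms(1) by simp
    then have "\<sigma> \<subseteq> {1..N} \<and> card \<sigma> = i" and "\<forall>s\<in>gap_sizes \<sigma>. a \<le> s"
      using 2(2) by (simp_all add: S_gap_def)
    moreover have "s < a" if "s \<in> {1..k - 1}" for s using that 2(1) by auto
    ultimately show ?thesis using leD by blast
  qed
next
  fix \<sigma> assume s: "\<sigma> \<in> ?R"
  then have fin: "finite \<sigma>" "\<sigma> \<noteq> {}" using assms by (auto intro: finite_subset)
  show "\<sigma> \<in> ?L"
  proof (cases "gaps \<sigma> = {}")
    case True
    then show ?thesis using s fin by (auto simp: S_gap_def)
  next
    case False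
    have "gaps \<sigma> \<subseteq> Pow {Min \<sigma>..Max \<sigma>}" by (auto simp: gaps_def run_outside_def)
    then have "finite (gaps \<sigma>)" by (rule finite_subset) simp
    then have fg: "finite (gap_sizes \<sigma>)" "gap_sizes \<sigma> \<noteq> {}" using False by (auto simp: gap_sizes_def)
    define a where "a = Min (gap_sizes \<sigma>)"
    have a: "a \<in> gap_sizes \<sigma>" "\<And>s. s \<in> gap_sizes \<sigma> \<Longrightarrow> a \<le> s"
      unfolding a_def using fg by auto
    \<comment> \<open>Gaps are nonempty intervals, so the least size is positive and cannot clash
      with the index 0, which encodes the absence of gaps.\<close>
    have "a \<noteq> 0" using a(1) by (auto simp: gap_sizes_def gaps_def run_outside_def)
    moreover have "a \<notin> {1..k - 1}" using s a(1) by auto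
    ultimately have "k \<le> a" by auto
    moreover have "\<sigma> \<in> S_gap N i a" using s fin a \<open>a \<noteq> 0\<close> by (auto simp: S_gap_def)
    ultimately show ?thesis by auto
  qed
qed

theorem theorem3p1:
  fixes k n i :: nat
  assumes "1 \<le> k" and "k \<le> n" and "1 \<le> i" and "i \<le> n - k + 1"
  shows "minimally_generated_by (poly_ring n) (lcm_ideal k n i :: 'a::field mpoly set) (m_sigma k)
           (S_gap (n - k + 1) i 0 \<union> (\<Union>a\<in>{k..}. S_gap (n - k + 1) i a))
       \<and> (\<forall>G. minimal_monomial_generators n (lcm_ideal k n i :: 'a mpoly set) G \<longleftrightarrow>
             G = m_sigma k ` {\<sigma>. \<sigma> \<subseteq> {1..n - k + 1} \<and> card \<sigma> = i \<and>
                                 (\<forall>s\<in>{1..k - 1}. s \<notin> gap_sizes \<sigma>)})"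
proof -
  define A where "A = {\<sigma>. \<sigma> \<subseteq> {1..n - k + 1} \<and> card \<sigma> = i \<and>
                          (\<forall>s\<in>{1..k - 1}. s \<notin> gap_sizes \<sigma>)}"
  define T where "T = {\<sigma>. \<sigma> \<subseteq> {1..n - k + 1} \<and> card \<sigma> = i}"
  define f where "f = (\<lambda>\<sigma>. lcm_exp (path_exp k ` \<sigma>))"
  define I where "I = (lcm_ideal k n i :: 'a mpoly set)"
  have m: "m_sigma k = (\<lambda>\<sigma>. monomial (f \<sigma>) :: 'a mpoly)"
    by (simp add: fun_eq_iff m_sigma_def f_def)
  have T: "finite \<sigma>" "\<sigma> \<noteq> {}" "\<sigma> \<subseteq> {1..n - k + 1}" "card \<sigma> = i" if "\<sigma> \<in> T" for \<sigma>
    using that assms by (auto simp: T_def intro: finite_subset)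
  have A: "A = {\<sigma> \<in> T. saturated k \<sigma>}"
    using saturated_iff_no_small_gaps[OF assms(1) T(1,2)] unfolding A_def T_def by auto
  have keys: "Poly_Mapping.keys (f \<sigma>) \<subseteq> {1..n}" if "\<sigma> \<in> T" for \<sigma>
    using T[OF that] cover_subset_iff[OF assms(1,2)] by (simp add: f_def keys_m_sigma_exp)
  have le: "exp_le (f \<sigma>) (f \<tau>) \<longleftrightarrow> cover k \<sigma> \<subseteq> cover k \<tau>" if "\<sigma> \<in> T" "\<tau> \<in> T" for \<sigma> \<tau>
    using T that by (simp add: f_def exp_le_m_sigma_iff)
  have anti: "\<sigma> = \<tau>" if "\<sigma> \<in> A" "\<tau> \<in> A" "exp_le (f \<sigma>) (f \<tau>)" for \<sigma> \<tau>
  proof -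
    have TT: "\<sigma> \<in> T" "\<tau> \<in> T" "saturated k \<tau>" using that by (simp_all add: A)
    then have "\<sigma> \<subseteq> \<tau>" using saturated_cover_subset le that(3) by blast
    \<comment> \<open>Both sets have \<open>i\<close> elements, so the inclusion is an
      equality.\<close>
    then show ?thesis using T(1)[OF TT(2)] T(4)[OF TT(1)] T(4)[OF TT(2)] by (simp add: card_subset_eq)
  qed
  have below: "\<exists>\<sigma>\<in>A. exp_le (f \<sigma>) (f \<tau>)" if \<tau>: "\<tau> \<in> T" for \<tau>
  proof -
    obtain \<sigma> where "\<sigma> \<subseteq> {1..n - k + 1}" "card \<sigma> = card \<tau>" "saturated k \<sigma>" "cover k \<sigma> \<subseteq> cover k \<tau>"
      using ex_saturated_below[OF assms(1,2) T(3)[OF \<tau>]] by blast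
    then have "\<sigma> \<in> A" "exp_le (f \<sigma>) (f \<tau>)"
      using T(4)[OF \<tau>] le[OF _ \<tau>, of \<sigma>] by (auto simp: A T_def)
    then show ?thesis by blast
  qed
  have "Idl\<^bsub>poly_ring n\<^esub> (monomial ` f ` A) = (Idl\<^bsub>poly_ring n\<^esub> (monomial ` f ` T) :: 'a mpoly set)"
    \<comment> \<open>One inclusion holds since \<open>A\<close> is part of \<open>T\<close>; the
      other is \<open>below\<close>.\<close>
    by (intro equalityI; subst genideal_monomial_subset_iff)
      (use keys below exp_le_refl in \<open>fastforce simp: A\<close>)+
  then have gen: "Idl\<^bsub>poly_ring n\<^esub> ((\<lambda>\<sigma>. monomial (f \<sigma>)) ` A) = I"
    unfolding I_def lcm_ideal_def m T_def by (simp add: image_image)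
  have min: "minimally_generated_by (poly_ring n) I (m_sigma k) A"
    unfolding m by (rule minimally_generated_by_monomialI) (use keys anti gen in \<open>auto simp: A\<close>)
  from minimally_generated_by_image[OF this]
  have "minimal_monomial_generators n I (m_sigma k ` A)"
    using keys unfolding minimal_monomial_generators_def m monomials_def
    by (auto simp: A image_image)
  then have "minimal_monomial_generators n I G \<longleftrightarrow> G = m_sigma k ` A" for G
    using minimal_monomial_generators_unique by blast
  then show ?thesis
    using min unfolding I_def S_gap_Un_eq[OF assms(1,3)] A_def by blast
qed

end
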